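(* The group $G=\langle a,t\mid t^2=1,\ atat=tata\rangle$, with generating set $\Sigma=\{a,t\}$ (so $\Sigma\cup\Sigma^{-1}=\{a,a^{-1},t\}$), does not satisfy the shortlex falsification by fellow traveller property (SL-FFTP) for the shortlex ordering induced by the order $a<t<a^{-1}$.
   Context: $\Sigma\cup\Sigma^{-1}=\{a,a^{-1},t\}$ is regarded as a subset of $G$ (note $t^{-1}=t$), and $\{a,a^{-1},t\}^*$ is the set of finite words over it; $|w|$ is the length of a word $w$, and $w=_Gv$ means that $w$ and $v$ represent the same element of $G$. Shortlex order. For words $w_1,w_2$ over a totally ordered alphabet $(S,<)$: $w_1<_{\mathrm{lex}}w_2$ iff $w_1$ is a strict prefix of $w_2$ or, in the first position where they differ, the letter of $w_1$ is smaller than that of $w_2$; $w_1<_{\mathrm{SL}}w_2$ iff $|w_1|<|w_2|$, or $|w_1|=|w_2|$ and $w_1<_{\mathrm{lex}}w_2$. For $g\in G$, $\mathrm{SL}(g)$ is the $<_{\mathrm{SL}}$-minimal word representing $g$, and $\mathrm{SL}_G=\{\mathrm{SL}(g):g\in G\}$. Fellow travelling. A word $w=s_1\cdots s_n$ determines the path in the Cayley graph of $G$ with respect to $\Sigma$ with vertices $v_0=1_G$, $v_i=s_1\cdots s_i$. For $K\ge 0$, two paths with vertex sequences $v_0,\dots,v_n$ and $u_0,\dots,u_m$ asynchronously $K$-fellow travel if there are non-decreasing maps $f:\{0,\dots,n\}\to\{0,\dots,m\}$ and $g:\{0,\dots,m\}\to\{0,\dots,n\}$ such that $d(v_i,u_{f(i)})\le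 K$ for all $i$ and $d(u_j,v_{g(j)})\le K$ for all $j$, where $d$ is the graph distance. Two words asynchronously $K$-fellow travel if their paths starting at $1_G$ do. SL-FFTP. $G$ has SL-FFTP with respect to $\Sigma$ (and the order $<$ on $\Sigma\cup\Sigma^{-1}$) if there is a constant $K\ge0$ such that for every word $w\in(\Sigma\cup\Sigma^{-1})^*$ with $w\notin\mathrm{SL}_G$ there is a word $v\in(\Sigma\cup\Sigma^{-1})^*$ that asynchronously $K$-fellow travels with $w$ and satisfies $w=_Gv$ and $v<_{\mathrm{SL}}w$. *)

theory Defs
  imports "HOL-Algebra.Algebra"
begin

section \<open>Group presentations\<close>

text \<open>
  The letter \<open>(x, True)\<close> stands for the generator \<open>x\<close> and \<open>(x, False)\<close> for its formal inverse.
  A set \<open>R\<close> of pairs of words is read as a set of defining relations \<open>l = r\<close>.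
\<close>

inductive pres_eq :: "(('x \<times> bool) list \<times> ('x \<times> bool) list) set \<Rightarrow>
    ('x \<times> bool) list \<Rightarrow> ('x \<times> bool) list \<Rightarrow> bool"
  for R where
  refl: "pres_eq R u u"
| sym: "pres_eq R u v \<Longrightarrow> pres_eq R v u"
| trans: "pres_eq R u v \<Longrightarrow> pres_eq R v w \<Longrightarrow> pres_eq R u w"
| cancel: "pres_eq R (u @ [(x, b), (x, \<not> b)] @ v) (u @ v)"
| relation: "(l, r) \<in> R \<Longrightarrow> pres_eq R (u @ l @ v) (u @ r @ v)"

definition pres_rel :: "(('x \<times> bool) list \<times> ('x \<times> bool) list) set \<Rightarrow>
    (('x \<times> bool) list \<times> ('x \<times> bool) list) set" where
  "pres_rel R = {(u, v). pres_eq R u v}"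

text \<open>All elements of the type \<open>'x\<close> are generators.\<close>

definition presented_group :: "(('x \<times> bool) list \<times> ('x \<times> bool) list) set \<Rightarrow>
    ('x \<times> bool) list set monoid" where
  "presented_group R =
     \<lparr>carrier = UNIV // pres_rel R,
      monoid.mult = (\<lambda>A B. \<Union>u\<in>A. \<Union>v\<in>B. pres_rel R `` {u @ v}),
      monoid.one = pres_rel R `` {[]}\<rparr>"

definition pres_gen :: "(('x \<times> bool) list \<times> ('x \<times> bool) list) set \<Rightarrow> 'x \<Rightarrow> ('x \<times> bool) list set" where
  "pres_gen R x = pres_rel R `` {[(x, True)]}"


section \<open>Words, shortlex normal forms and the Cayley graph\<close>

definition symm :: "('g, 'm) monoid_scheme \<Rightarrow> 'g set \<Rightarrow> 'g set" where
  "symm G \<Sigma> = \<Sigma> \<union> m_inv G ` \<Sigma>"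

definition word_val :: "('g, 'm) monoid_scheme \<Rightarrow> 'g list \<Rightarrow> 'g" where
  "word_val G w = foldr (\<lambda>x y. x \<otimes>\<^bsub>G\<^esub> y) w \<one>\<^bsub>G\<^esub>"

text \<open>
  Here \<open>r\<close> is a strict total order on \<^term>\<open>symm G \<Sigma>\<close>, given as the set of pairs \<open>(x, y)\<close>
  with \<open>x < y\<close>; then \<^term>\<open>lenlex r\<close> is the shortlex order (shorter words first, words of
  equal length lexicographically).
  The description below is definite when \<open>g\<close> is the value of a word over \<^term>\<open>symm G \<Sigma>\<close>.
\<close>

definition SL :: "('g, 'm) monoid_scheme \<Rightarrow> 'g set \<Rightarrow> ('g \<times> 'g) set \<Rightarrow> 'g \<Rightarrow> 'g list" where
  "SL G \<Sigma> r g = (THE w. w \<in> lists (symm G \<Sigma>) \<and> word_val G w = g \<and>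
     (\<forall>v\<in>lists (symm G \<Sigma>). word_val G v = g \<and> v \<noteq> w \<longrightarrow> (w, v) \<in> lenlex r))"

definition SL_words :: "('g, 'm) monoid_scheme \<Rightarrow> 'g set \<Rightarrow> ('g \<times> 'g) set \<Rightarrow> 'g list set" where
  "SL_words G \<Sigma> r = SL G \<Sigma> r ` carrier G"

definition cayley_edges :: "('g, 'm) monoid_scheme \<Rightarrow> 'g set \<Rightarrow> ('g \<times> 'g) set" where
  "cayley_edges G \<Sigma> = {(g, g \<otimes>\<^bsub>G\<^esub> s) | g s. g \<in> carrier G \<and> s \<in> symm G \<Sigma>}"

text \<open>
  The relational power relates the ends of edge paths with \<open>n\<close> edges.  If \<open>\<Sigma>\<close> generates \<open>G\<close>,
  the Cayley graph is connected and the set of such \<open>n\<close> is nonempty.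
\<close>

definition cayley_dist :: "('g, 'm) monoid_scheme \<Rightarrow> 'g set \<Rightarrow> 'g \<Rightarrow> 'g \<Rightarrow> nat" where
  "cayley_dist G \<Sigma> g h = (LEAST n. (g, h) \<in> cayley_edges G \<Sigma> ^^ n)"


section \<open>Asynchronous fellow travelling and SL-FFTP\<close>

definition word_path :: "('g, 'm) monoid_scheme \<Rightarrow> 'g list \<Rightarrow> nat \<Rightarrow> 'g" where
  "word_path G w i = word_val G (take i w)"

definition async_fellow_travel ::
    "('g, 'm) monoid_scheme \<Rightarrow> 'g set \<Rightarrow> nat \<Rightarrow> 'g list \<Rightarrow> 'g list \<Rightarrow> bool" where
  "async_fellow_travel G \<Sigma> K w u \<longleftrightarrow>
     (\<exists>f g :: nat \<Rightarrow> nat.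
        f \<in> {0..length w} \<rightarrow> {0..length u} \<and> mono_on {0..length w} f \<and>
        g \<in> {0..length u} \<rightarrow> {0..length w} \<and> mono_on {0..length u} g \<and>
        (\<forall>i\<in>{0..length w}. cayley_dist G \<Sigma> (word_path G w i) (word_path G u (f i)) \<le> K) \<and>
        (\<forall>j\<in>{0..length u}. cayley_dist G \<Sigma> (word_path G u j) (word_path G w (g j)) \<le> K))"

definition SL_FFTP :: "('g, 'm) monoid_scheme \<Rightarrow> 'g set \<Rightarrow> ('g \<times> 'g) set \<Rightarrow> bool" where
  "SL_FFTP G \<Sigma> r \<longleftrightarrow>
     (\<exists>K. \<forall>w\<in>lists (symm G \<Sigma>). w \<notin> SL_words G \<Sigma> r \<longrightarrow>
        (\<exists>v\<in>lists (symm G \<Sigma>). async_fellow_travel G \<Sigma> K v w \<and>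
           word_val G w = word_val G v \<and> (v, w) \<in> lenlex r))"


section \<open>The group \<open>\<langle>a, t | t\<^sup>2 = 1, atat = tata\<rangle>\<close>\<close>

datatype gen = Gen_a | Gen_t

definition at_rels :: "((gen \<times> bool) list \<times> (gen \<times> bool) list) set" where
  "at_rels =
     (let a = (Gen_a, True); t = (Gen_t, True)
      in {([t, t], []), ([a, t, a, t], [t, a, t, a])})"

definition at_group :: "(gen \<times> bool) list set monoid" where
  "at_group = presented_group at_rels"

definition at_a :: "(gen \<times> bool) list set" where
  "at_a = pres_gen at_rels Gen_a"

definition at_t :: "(gen \<times> bool) list set" where
  "at_t = pres_gen at_rels Gen_t"

text \<open>The order \<open>a < t < a\<^sup>-\<^sup>1\<close> on \<open>\<Sigma> \<union> \<Sigma>\<^sup>-\<^sup>1 = {a, a\<^sup>-\<^sup>1, t}\<close>.\<close>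

definition at_order :: "((gen \<times> bool) list set \<times> (gen \<times> bool) list set) set" where
  "at_order = {(at_a, at_t), (at_t, inv\<^bsub>at_group\<^esub> at_a), (at_a, inv\<^bsub>at_group\<^esub> at_a)}"


subsection \<open>Well-definedness\<close>

lemma pres_eq_append:
  assumes "pres_eq R u u'" shows "pres_eq R (p @ u @ q) (p @ u' @ q)"
  using assms
proof induction
  case (cancel u x b v)
  then show ?case using pres_eq.cancel[of R "p @ u" x b "v @ q"] by simp
next
  case (relation l r u v)
  then show ?case using pres_eq.relation[of l r R "p @ u" "v @ q"] by simp
next
  case (trans u v w)
  show ?case using trans.IH by (rule pres_eq.trans)
qed (rule pres_eq.refl, erule pres_eq.sym)

lemma pres_eq_append2:
  assumes "pres_eq R u u'" "pres_eq R v v'"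
  shows "pres_eq R (u @ v) (u' @ v')"
proof (rule pres_eq.trans)
  show "pres_eq R (u @ v) (u' @ v)"
    using pres_eq_append[OF assms(1), of "[]" v] by simp
  show "pres_eq R (u' @ v) (u' @ v')"
    using pres_eq_append[OF assms(2), of u' "[]"] by simp
qed

lemma equiv_pres_rel: "equiv UNIV (pres_rel R)"
proof (rule equivI)
  show "refl_on UNIV (pres_rel R)"
    by (auto simp: pres_rel_def refl_on_def pres_eq.refl)
  show "sym_on UNIV (pres_rel R)"
    unfolding pres_rel_def by (rule symI) (simp add: pres_eq.sym)
  show "trans_on UNIV (pres_rel R)"
    unfolding pres_rel_def by (rule transI) (simp, erule (1) pres_eq.trans)
qed simp

lemma pres_class_eq: "pres_rel R `` {u} = pres_rel R `` {v} \<longleftrightarrow> pres_eq R u v"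
  using eq_equiv_class_iff[OF equiv_pres_rel, of u v R] by (simp add: pres_rel_def)

lemma pres_mult:
  "pres_rel R `` {u} \<otimes>\<^bsub>presented_group R\<^esub> pres_rel R `` {v} = pres_rel R `` {u @ v}"
proof -
  have eq: "pres_rel R `` {u' @ v'} = pres_rel R `` {u @ v}"
    if "u' \<in> pres_rel R `` {u}" "v' \<in> pres_rel R `` {v}" for u' v'
  proof -
    from that have "pres_eq R u u'" "pres_eq R v v'" by (simp_all add: pres_rel_def)
    then show ?thesis unfolding pres_class_eq by (intro pres_eq.sym[OF pres_eq_append2])
  qed
  have mem: "u \<in> pres_rel R `` {u}" for u
    using pres_eq.refl[of R u] by (simp add: pres_rel_def)
  have "(\<Union>v'\<in>pres_rel R `` {v}. pres_rel R `` {u' @ v'}) = pres_rel R `` {u @ v}"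
    if "u' \<in> pres_rel R `` {u}" for u'
    by (rule UN_constant_eq[OF mem[of v]]) (intro ballI eq that)
  then have "(\<Union>u'\<in>pres_rel R `` {u}. \<Union>v'\<in>pres_rel R `` {v}. pres_rel R `` {u' @ v'}) =
      pres_rel R `` {u @ v}"
    by (intro UN_constant_eq[OF mem[of u]] ballI)
  then show ?thesis
    by (simp only: presented_group_def monoid.simps)
qed

lemma pres_carrier: "carrier (presented_group R) = range (\<lambda>u. pres_rel R `` {u})"
  by (auto simp: presented_group_def quotient_def)

lemma pres_one: "\<one>\<^bsub>presented_group R\<^esub> = pres_rel R `` {[]}"
  by (simp add: presented_group_def)

lemma pres_inverse: "pres_eq R (map (\<lambda>(x, b). (x, \<not> b)) (rev u) @ u) []"
proof (induction u)
  case (Cons z u)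
  obtain x b where z: "z = (x, b)" by (cases z)
  let ?i = "map (\<lambda>(x, b). (x, \<not> b)) (rev u)"
  have "pres_eq R (?i @ [(x, \<not> b), (x, \<not> \<not> b)] @ u) (?i @ u)"
    by (rule pres_eq.cancel)
  from pres_eq.trans[OF this Cons] show ?case by (simp add: z)
qed (simp add: pres_eq.refl)

lemma group_presented_group: "group (presented_group R)"
proof (rule groupI)
  fix x assume "x \<in> carrier (presented_group R)"
  then obtain u where u: "x = pres_rel R `` {u}" by (auto simp: pres_carrier)
  show "\<exists>y\<in>carrier (presented_group R). y \<otimes>\<^bsub>presented_group R\<^esub> x = \<one>\<^bsub>presented_group R\<^esub>"
    by (rule bexI[of _ "pres_rel R `` {map (\<lambda>(x, b). (x, \<not> b)) (rev u)}"])
      (auto simp: u pres_mult pres_one pres_class_eq pres_inverse pres_carrier)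
qed (auto simp: pres_carrier pres_mult pres_one)

lemma group_at: "group at_group"
  by (simp add: at_group_def group_presented_group)

lemma inv_pres_gen:
  "inv\<^bsub>presented_group R\<^esub> (pres_gen R x) = pres_rel R `` {[(x, False)]}"
proof -
  interpret group "presented_group R" by (rule group_presented_group)
  have "pres_eq R [(x, False), (x, True)] []"
    using pres_eq.cancel[of R "[]" x False "[]"] by simp
  then show ?thesis
    by (intro inv_equality)
      (auto simp: pres_gen_def pres_mult pres_one pres_class_eq pres_carrier)
qed

lemma generate_presented_group:
  "generate (presented_group R) (range (pres_gen R)) = carrier (presented_group R)"
proof -
  interpret group "presented_group R" by (rule group_presented_group)
  have "pres_rel R `` {u} \<in> generate (presented_group R) (range (pres_gen R))" for u
  proof (induction u)
    case Nil
    show ?case using generate.one[of "presented_group R"] by (simp add: pres_one)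
  next
    case (Cons z u)
    obtain x b where z: "z = (x, b)" by (cases z)
    have "pres_rel R `` {[(x, b)]} \<in> generate (presented_group R) (range (pres_gen R))"
    proof (cases b)
      case True
      then show ?thesis
        using generate.incl[of "pres_gen R x" "range (pres_gen R)"] by (simp add: pres_gen_def)
    next
      case False
      then show ?thesis
        using generate.inv[of "pres_gen R x" "range (pres_gen R)" "presented_group R"]
        by (simp add: inv_pres_gen)
    qed
    from generate.eng[OF this Cons] show ?case by (simp add: z pres_mult)
  qed
  moreover have "range (pres_gen R) \<subseteq> carrier (presented_group R)"
    by (auto simp: pres_gen_def pres_carrier)
  ultimately show ?thesis
    using generate_incl[of "range (pres_gen R)"] unfolding pres_carrier by blast
qed

lemma generate_at: "generate at_group {at_a, at_t} = carrier at_group"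
proof -
  have "(UNIV :: gen set) = {Gen_a, Gen_t}"
    using gen.exhaust by auto
  from arg_cong[OF this, of "image (pres_gen at_rels)"]
  have "range (pres_gen at_rels) = {at_a, at_t}"
    by (simp add: at_a_def at_t_def)
  then show ?thesis using generate_presented_group[of at_rels] by (simp add: at_group_def)
qed

lemma inv_at_t: "inv\<^bsub>at_group\<^esub> at_t = at_t"
proof -
  interpret group at_group by (rule group_at)
  have "([(Gen_t, True), (Gen_t, True)], []) \<in> at_rels"
    by (simp add: at_rels_def Let_def)
  from pres_eq.relation[OF this, of "[]" "[]"]
  have "at_t \<otimes>\<^bsub>at_group\<^esub> at_t = \<one>\<^bsub>at_group\<^esub>"
    by (simp add: at_group_def at_t_def pres_gen_def pres_mult pres_one pres_class_eq)
  moreover have "at_t \<in> carrier at_group"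
    by (simp add: at_group_def at_t_def pres_gen_def pres_carrier)
  ultimately show ?thesis by (simp add: inv_equality)
qed

lemma symm_at: "symm at_group {at_a, at_t} = {at_a, inv\<^bsub>at_group\<^esub> at_a, at_t}"
  by (auto simp: symm_def inv_at_t)

lemma at_letters_distinct:
  "at_a \<noteq> at_t" "at_a \<noteq> inv\<^bsub>at_group\<^esub> at_a" "at_t \<noteq> inv\<^bsub>at_group\<^esub> at_a"
proof -
  define e :: "gen \<times> bool \<Rightarrow> int"
    where "e z = (if fst z = Gen_a then if snd z then 1 else -1 else 0)" for z
  have *: "sum_list (map e u) = sum_list (map e v)" if "pres_eq at_rels u v" for u v
    using that
  proof induction
    case (cancel u x b v)
    then show ?case by (simp add: e_def)
  next
    case (relation l r u v)
    then show ?case by (auto simp: at_rels_def Let_def e_def)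
  qed simp_all
  have inv_a: "inv\<^bsub>at_group\<^esub> at_a = pres_rel at_rels `` {[(Gen_a, False)]}"
    by (simp only: at_group_def at_a_def inv_pres_gen)
  have a: "at_a = pres_rel at_rels `` {[(Gen_a, True)]}"
    and t: "at_t = pres_rel at_rels `` {[(Gen_t, True)]}"
    by (simp_all only: at_a_def at_t_def pres_gen_def)
  show "at_a \<noteq> at_t"
    unfolding a t pres_class_eq using *[of "[(Gen_a, True)]" "[(Gen_t, True)]"]
    by (auto simp: e_def)
  show "at_a \<noteq> inv\<^bsub>at_group\<^esub> at_a"
    unfolding inv_a unfolding a pres_class_eq
    using *[of "[(Gen_a, True)]" "[(Gen_a, False)]"] by (auto simp: e_def)
  show "at_t \<noteq> inv\<^bsub>at_group\<^esub> at_a"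
    unfolding inv_a t pres_class_eq
    using *[of "[(Gen_t, True)]" "[(Gen_a, False)]"] by (auto simp: e_def)
qed

lemma at_order_strict_total:
  "trans at_order" "irrefl at_order" "total_on (symm at_group {at_a, at_t}) at_order"
proof -
  show "trans at_order"
    using at_letters_distinct by (intro transI) (simp add: at_order_def, metis)
  show "irrefl at_order"
    using at_letters_distinct by (auto simp: irrefl_def at_order_def)
  show "total_on (symm at_group {at_a, at_t}) at_order"
    by (intro total_onI) (simp add: at_order_def symm_at, metis)
qed

end

theory Submission
  imports Defs
begin

text \<open>
  Put \<open>b = tat\<close>.  Then \<open>a\<close> and \<open>b\<close> commute and \<open>t\<close> swaps them, so \<open>a\<^sup>x b\<^sup>y t\<^sup>e\<close> has
  coordinates in \<open>\<int>\<^sup>2 \<rtimes> \<int>/2\<close>, and a letter \<open>a\<^sup>\<plusminus>\<^sup>1\<close> of a word changes \<open>x\<close> or \<open>y\<close>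
  according to the parity of the number of letters \<open>t\<close> before it.  The word
  \<open>w = t a\<^sup>n t a\<^sup>-\<^sup>n t\<close> equals the shorter \<open>a\<^sup>-\<^sup>n t a\<^sup>n\<close>, and its path passes through the corner
  \<open>(0, n)\<close> on the way to \<open>(-n, n)\<close>.  A word \<open>v <\<^sub>S\<^sub>L w\<close> with the same value has an odd number of
  letters \<open>t\<close>.  If it has only one, its path first moves along \<open>y = 0\<close> and then along
  \<open>x = -n\<close>, hence stays at distance at least \<open>n\<close> from the corner.  Otherwise the bound
  \<open>|v| \<le> 2n + 3\<close> forces exactly three \<open>t\<close> and \<open>2n\<close> letters \<open>a\<^sup>\<plusminus>\<^sup>1\<close>, and \<open>w\<close> is the
  lexicographically smallest such word because \<open>a < t < a\<^sup>-\<^sup>1\<close>.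
\<close>

section \<open>Words over a generating set\<close>

lemma symm_subset_carrier:
  assumes "group G" "\<Sigma> \<subseteq> carrier G"
  shows "symm G \<Sigma> \<subseteq> carrier G"
proof -
  interpret group G by fact
  show ?thesis using assms(2) by (auto simp: symm_def)
qed

lemma word_val_closed:
  assumes "group G" "w \<in> lists (carrier G)"
  shows "word_val G w \<in> carrier G"
proof -
  interpret group G by fact
  show ?thesis using assms(2) by (induction w) (auto simp: word_val_def)
qed

lemma word_val_append:
  assumes "group G" "u \<in> lists (carrier G)" "v \<in> lists (carrier G)"
  shows "word_val G (u @ v) = word_val G u \<otimes>\<^bsub>G\<^esub> word_val G v"
proof -
  interpret group G by fact
  show ?thesis using assms(2)
  proof (induction u)
    case Nil
    then show ?case using word_val_closed[OF assms(1,3)] by (simp add: word_val_def)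
  next
    case (Cons x u)
    then show ?case
      using word_val_closed[OF assms(1,3)] word_val_closed[OF assms(1), of u]
      by (simp add: word_val_def m_assoc)
  qed
qed

lemma word_val_replicate:
  assumes "group G" "x \<in> carrier G"
  shows "word_val G (replicate n x) = x [^]\<^bsub>G\<^esub> n"
proof -
  interpret group G by fact
  show ?thesis
    using nat_pow_mult[OF assms(2), of 1] assms(2)
    by (induction n) (simp_all add: word_val_def del: nat_pow_mult nat_pow_Suc)
qed

lemma generate_imp_word_val:
  assumes "group G" "\<Sigma> \<subseteq> carrier G" "g \<in> generate G \<Sigma>"
  shows "\<exists>u\<in>lists (symm G \<Sigma>). word_val G u = g"
proof -
  interpret group G by fact
  have sub: "symm G \<Sigma> \<subseteq> carrier G" by (rule symm_subset_carrier[OF assms(1,2)])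
  have letter: "\<exists>u\<in>lists (symm G \<Sigma>). word_val G u = s" if "s \<in> symm G \<Sigma>" for s
    using that sub by (intro bexI[of _ "[s]"]) (auto simp: word_val_def)
  show ?thesis using assms(3)
  proof induction
    case one
    show ?case by (intro bexI[of _ "[]"]) (auto simp: word_val_def)
  next
    case (incl h)
    then show ?case by (intro letter) (simp add: symm_def)
  next
    case (inv h)
    then show ?case by (intro letter) (simp add: symm_def)
  next
    case (eng h1 h2)
    then obtain u v where
      "u \<in> lists (symm G \<Sigma>)" "word_val G u = h1" "v \<in> lists (symm G \<Sigma>)" "word_val G v = h2"
      by blast
    moreover have "u \<in> lists (carrier G)" "v \<in> lists (carrier G)"
      using calculation lists_mono[OF sub] by blast+
    ultimately show ?case
      by (intro bexI[of _ "u @ v"]) (simp_all add: word_val_append[OF assms(1)])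
  qed
qed

section \<open>Shortlex normal forms as least words\<close>

text \<open>Words of different length are compared by length; at equal length the first differing
  letters both lie in \<open>A\<close> and are therefore comparable.\<close>

lemma total_on_lists_lenlex:
  assumes "total_on A r"
  shows "total_on (lists A) (lenlex r)"
proof (rule total_onI)
  fix u v assume uv: "u \<in> lists A" "v \<in> lists A" "u \<noteq> v"
  show "(u, v) \<in> lenlex r \<or> (v, u) \<in> lenlex r"
  proof (cases "length u = length v")
    case True
    obtain p x u' y v' where "x \<noteq> y" and eq: "u = p @ [x] @ u'" "v = p @ [y] @ v'"
      using same_length_different[OF uv(3) True] by blast
    moreover have "x \<in> A" "y \<in> A" using uv(1,2) unfolding eq by auto
    ultimately have "(x, y) \<in> r \<or> (y, x) \<in> r" using assms by (auto simp: total_on_def)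
    moreover have "length u' = length v'" using True by (simp add: eq)
    ultimately show ?thesis unfolding eq lenlex_conv by (auto intro: lex_append_leftI)
  qed (auto simp: lenlex_conv)
qed

text \<open>\<open>SL\<close> is a definite description and says nothing until a unique least word
  is known to exist. Generation supplies some word for \<open>g\<close>, well-foundedness of
  \<open>lenlex r\<close> a minimal one, and totality makes the minimal word least.\<close>

lemma SL_word_val_minimal:
  assumes G: "group G" "\<Sigma> \<subseteq> carrier G" "generate G \<Sigma> = carrier G"
    and r: "wf r" "total_on (symm G \<Sigma>) r" and g: "g \<in> carrier G"
  shows "word_val G (SL G \<Sigma> r g) = g"
    and "v \<in> lists (symm G \<Sigma>) \<Longrightarrow> word_val G v = g \<Longrightarrow> (v, SL G \<Sigma> r g) \<notin> lenlex r"
proof -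
  let ?S = "{u \<in> lists (symm G \<Sigma>). word_val G u = g}"
  let ?P = "\<lambda>w. w \<in> lists (symm G \<Sigma>) \<and> word_val G w = g \<and>
     (\<forall>v\<in>lists (symm G \<Sigma>). word_val G v = g \<and> v \<noteq> w \<longrightarrow> (w, v) \<in> lenlex r)"
  have wf: "wf (lenlex r)" using r(1) by (rule wf_lenlex)
  obtain u where "u \<in> ?S" using generate_imp_word_val[OF G(1,2)] g G(3) by blast
  then obtain w where w: "w \<in> ?S" "\<And>v. (v, w) \<in> lenlex r \<Longrightarrow> v \<notin> ?S"
    by (rule wfE_min[OF wf]) blast
  have "?P w"
  proof (intro conjI ballI impI)
    fix v assume v: "v \<in> lists (symm G \<Sigma>)" "word_val G v = g \<and> v \<noteq> w"
    then have "(v, w) \<notin> lenlex r" using w(2)[of v] by fast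
    then show "(w, v) \<in> lenlex r"
      using total_on_lists_lenlex[OF r(2)] v w(1) unfolding total_on_def by blast
  qed (use w(1) in simp_all)
  moreover have "w' = w" if "?P w'" for w'
  proof (rule ccontr)
    assume "w' \<noteq> w"
    then have "(w', w) \<in> lenlex r" "(w, w') \<in> lenlex r"
      using that \<open>?P w\<close> by metis+
    with wf_not_sym[OF wf] show False by metis
  qed
  ultimately have SL: "?P (SL G \<Sigma> r g)"
    unfolding SL_def by (rule theI[where P = "?P"])
  then show "word_val G (SL G \<Sigma> r g) = g" by (elim conjE)
  show "(v, SL G \<Sigma> r g) \<notin> lenlex r"
    if v: "v \<in> lists (symm G \<Sigma>)" "word_val G v = g"
  proof (cases "v = SL G \<Sigma> r g")
    case True
    then show ?thesis using wf_not_refl[OF wf] by simp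
  next
    case False
    then have "(SL G \<Sigma> r g, v) \<in> lenlex r" using SL v by simp
    then show ?thesis by (rule wf_not_sym[OF wf])
  qed
qed

text \<open>Used contrapositively: one smaller word with the same value shows that a word is not a
  normal form.\<close>

lemma SL_words_minimal:
  assumes "group G" "\<Sigma> \<subseteq> carrier G" "generate G \<Sigma> = carrier G"
    and "wf r" "total_on (symm G \<Sigma>) r"
    and "w \<in> SL_words G \<Sigma> r" "v \<in> lists (symm G \<Sigma>)" "word_val G v = word_val G w"
  shows "(v, w) \<notin> lenlex r"
proof -
  obtain g where "g \<in> carrier G" "w = SL G \<Sigma> r g"
    using assms(6) by (auto simp: SL_words_def)
  then show ?thesis using SL_word_val_minimal[OF assms(1-5)] assms(7,8) by metis
qed

section \<open>Distance in the Cayley graph\<close>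

lemma cayley_path_word_val:
  assumes "group G" "\<Sigma> \<subseteq> carrier G" "g \<in> carrier G" "u \<in> lists (symm G \<Sigma>)"
  shows "(g, g \<otimes>\<^bsub>G\<^esub> word_val G u) \<in> cayley_edges G \<Sigma> ^^ length u"
proof -
  interpret group G by fact
  have sub: "symm G \<Sigma> \<subseteq> carrier G" by (rule symm_subset_carrier[OF assms(1,2)])
  show ?thesis using assms(4,3)
  proof (induction u arbitrary: g)
    case Nil
    then show ?case by (simp add: word_val_def)
  next
    case (Cons s u)
    have s: "s \<in> carrier G" and u: "u \<in> lists (carrier G)"
      using Cons sub lists_mono[OF sub] by blast+
    have "(g, g \<otimes>\<^bsub>G\<^esub> s) \<in> cayley_edges G \<Sigma>"
      using Cons by (auto simp: cayley_edges_def)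
    moreover have "(g \<otimes>\<^bsub>G\<^esub> s, g \<otimes>\<^bsub>G\<^esub> s \<otimes>\<^bsub>G\<^esub> word_val G u) \<in> cayley_edges G \<Sigma> ^^ length u"
      using Cons s by simp
    moreover have "g \<otimes>\<^bsub>G\<^esub> s \<otimes>\<^bsub>G\<^esub> word_val G u = g \<otimes>\<^bsub>G\<^esub> word_val G (s # u)"
      using Cons.prems s word_val_closed[OF assms(1) u] by (simp add: word_val_def m_assoc)
    ultimately show ?case by (metis relpow_Suc_I2 length_Cons)
  qed
qed

text \<open>A word for the quotient of \<open>h\<close> by \<open>g\<close> labels an edge path from
  \<open>g\<close> to \<open>h\<close>, so the \<open>LEAST\<close> in \<open>cayley_dist\<close>
  ranges over a nonempty set and is the length of an actual path.\<close>

lemma cayley_dist_attained: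
  assumes "group G" "\<Sigma> \<subseteq> carrier G" "generate G \<Sigma> = carrier G"
    and "g \<in> carrier G" "h \<in> carrier G"
  shows "(g, h) \<in> cayley_edges G \<Sigma> ^^ cayley_dist G \<Sigma> g h"
proof -
  interpret group G by fact
  obtain u where u: "u \<in> lists (symm G \<Sigma>)" "word_val G u = inv\<^bsub>G\<^esub> g \<otimes>\<^bsub>G\<^esub> h"
    using generate_imp_word_val[OF assms(1,2)] assms(3-5) by blast
  have "(g, h) \<in> cayley_edges G \<Sigma> ^^ length u"
    using cayley_path_word_val[OF assms(1,2,4) u(1)] u(2) assms(4,5)
    by (simp flip: m_assoc)
  then show ?thesis unfolding cayley_dist_def by (rule LeastI)
qed


section \<open>Coordinates\<close>

text \<open>Right multiplication by a letter on \<open>a^x b^y t^e\<close>. Since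
  \<open>t a = b t\<close>, a letter \<open>a\<close> acts on the exponent of \<open>b\<close> when
  \<open>e\<close> holds; \<open>t\<close> equals its own inverse, so the sign of
  \<open>Gen_t\<close> is ignored.\<close>

fun coord_step :: "int \<times> int \<times> bool \<Rightarrow> gen \<times> bool \<Rightarrow> int \<times> int \<times> bool" where
  "coord_step (x, y, e) (Gen_t, b) = (x, y, \<not> e)"
| "coord_step (x, y, e) (Gen_a, b) =
     (let d = (if b then 1 else -1) in if e then (x, y + d, e) else (x + d, y, e))"

definition coord :: "(gen \<times> bool) list set \<Rightarrow> int \<times> int \<times> bool" where
  "coord g = foldl coord_step (0, 0, False) (SOME u. u \<in> g)"

text \<open>It suffices that relators act trivially on every state: \<open>tt\<close> flips the
  Boolean twice, and \<open>atat\<close> and \<open>tata\<close> both add one to each coordinate.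
  This makes the choice of representative in \<open>coord\<close> harmless.\<close>

lemma foldl_coord_step_pres_eq:
  "pres_eq at_rels u v \<Longrightarrow> foldl coord_step s u = foldl coord_step s v"
proof (induction arbitrary: s rule: pres_eq.induct)
  case (cancel u x b v)
  obtain i j e where "foldl coord_step s u = (i, j, e)" by (metis prod_cases3)
  then show ?case by (cases x) (simp_all add: Let_def)
next
  case (relation l r u v)
  obtain i j e where "foldl coord_step s u = (i, j, e)" by (metis prod_cases3)
  then show ?case using relation by (auto simp: at_rels_def Let_def)
qed simp_all

lemma coord_class: "coord (pres_rel at_rels `` {u}) = foldl coord_step (0, 0, False) u"
proof -
  have "u \<in> pres_rel at_rels `` {u}" by (simp add: pres_rel_def pres_eq.refl)
  then have "(SOME v. v \<in> pres_rel at_rels `` {u}) \<in> pres_rel at_rels `` {u}"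
    by (rule someI)
  then have "pres_eq at_rels u (SOME v. v \<in> pres_rel at_rels `` {u})"
    by (simp add: pres_rel_def)
  then show ?thesis unfolding coord_def by (metis foldl_coord_step_pres_eq)
qed

lemma coord_mult_letter:
  assumes "g \<in> carrier at_group"
  shows "coord (g \<otimes>\<^bsub>at_group\<^esub> pres_rel at_rels `` {[z]}) = coord_step (coord g) z"
proof -
  obtain u where u: "g = pres_rel at_rels `` {u}"
    using assms by (auto simp: at_group_def pres_carrier)
  show ?thesis unfolding u at_group_def pres_mult coord_class by simp
qed

abbreviation at_A :: "(gen \<times> bool) list set" where
  "at_A \<equiv> inv\<^bsub>at_group\<^esub> at_a"

lemma at_letter_classes:
  "at_a = pres_rel at_rels `` {[(Gen_a, True)]}"
  "at_A = pres_rel at_rels `` {[(Gen_a, False)]}"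
  "at_t = pres_rel at_rels `` {[(Gen_t, True)]}"
proof -
  show "at_A = pres_rel at_rels `` {[(Gen_a, False)]}"
    by (simp only: at_a_def at_group_def inv_pres_gen)
qed (simp_all only: at_a_def at_t_def pres_gen_def)

lemma coord_mult:
  assumes "g \<in> carrier at_group" "coord g = (x, y, e)"
  shows "coord (g \<otimes>\<^bsub>at_group\<^esub> at_a) = (if e then (x, y + 1, e) else (x + 1, y, e))"
    and "coord (g \<otimes>\<^bsub>at_group\<^esub> at_A) = (if e then (x, y - 1, e) else (x - 1, y, e))"
    and "coord (g \<otimes>\<^bsub>at_group\<^esub> at_t) = (x, y, \<not> e)"
  using coord_mult_letter[OF assms(1), of "(Gen_a, True)"]
    coord_mult_letter[OF assms(1), of "(Gen_a, False)"]
    coord_mult_letter[OF assms(1), of "(Gen_t, True)"]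
  by (simp_all only: at_letter_classes[symmetric] assms(2) coord_step.simps Let_def) simp_all

abbreviation at_letters :: "(gen \<times> bool) list set set" where
  "at_letters \<equiv> symm at_group {at_a, at_t}"

lemma at_letters_simps [simp]:
  "at_a \<in> at_letters" "at_A \<in> at_letters" "at_t \<in> at_letters"
  by (simp_all add: symm_at)

lemmas [simp] = at_letters_distinct at_letters_distinct[symmetric]

lemma at_letters_cases:
  assumes "s \<in> at_letters"
  obtains "s = at_a" | "s = at_A" | "s = at_t"
  using assms by (auto simp only: symm_at insert_iff empty_iff)

lemma replicate_in_lists [simp]: "x \<in> A \<Longrightarrow> replicate n x \<in> lists A"
  by (induction n) simp_all

lemma at_gens_carrier: "{at_a, at_t} \<subseteq> carrier at_group"
  by (auto simp: at_group_def at_a_def at_t_def pres_gen_def pres_carrier)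

lemma at_letters_carrier: "at_letters \<subseteq> carrier at_group"
  by (rule symm_subset_carrier[OF group_at at_gens_carrier])

lemma at_words_carrier: "w \<in> lists at_letters \<Longrightarrow> w \<in> lists (carrier at_group)"
  using lists_mono[OF at_letters_carrier] by blast

section \<open>A lower bound for the Cayley distance\<close>

definition l1_dist :: "(gen \<times> bool) list set \<Rightarrow> (gen \<times> bool) list set \<Rightarrow> int" where
  "l1_dist g h = \<bar>fst (coord h) - fst (coord g)\<bar> + \<bar>fst (snd (coord h)) - fst (snd (coord g))\<bar>"

text \<open>An edge labelled \<open>t\<close> fixes both planar coordinates, and an edge labelled by
  \<open>a\<close> or its inverse changes one of them by one; the bounds add up along the
  path.\<close>

lemma l1_dist_le_cayley_path:
  "(g, h) \<in> cayley_edges at_group {at_a, at_t} ^^ n \<Longrightarrow> l1_dist g h \<le> int n"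
proof (induction n arbitrary: h)
  case 0
  then show ?case by (simp add: l1_dist_def)
next
  case (Suc n)
  then obtain k s where k: "(g, k) \<in> cayley_edges at_group {at_a, at_t} ^^ n"
    "h = k \<otimes>\<^bsub>at_group\<^esub> s" "k \<in> carrier at_group" "s \<in> at_letters"
    by (auto simp: cayley_edges_def)
  obtain x y e where c: "coord k = (x, y, e)" by (metis prod_cases3)
  have "l1_dist k h \<le> 1"
    using k(2,4) coord_mult[OF k(3) c] c by (auto simp: symm_at l1_dist_def)
  then show ?case using Suc.IH[OF k(1)] by (simp add: l1_dist_def)
qed

lemma l1_dist_le_cayley_dist:
  assumes "g \<in> carrier at_group" "h \<in> carrier at_group"
  shows "l1_dist g h \<le> int (cayley_dist at_group {at_a, at_t} g h)"
  using cayley_dist_attained[OF group_at at_gens_carrier generate_at assms]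
  by (rule l1_dist_le_cayley_path)

section \<open>Coordinates along the path of a word\<close>

definition wcoord :: "(gen \<times> bool) list set list \<Rightarrow> int \<times> int \<times> bool" where
  "wcoord w = coord (word_val at_group w)"

lemma wcoord_Nil [simp]: "wcoord [] = (0, 0, False)"
  using coord_class[of "[]"] by (simp add: wcoord_def word_val_def at_group_def pres_one)

lemma wcoord_snoc:
  assumes "w \<in> lists at_letters" "wcoord w = (x, y, e)"
  shows "wcoord (w @ [at_a]) = (if e then (x, y + 1, e) else (x + 1, y, e))"
    and "wcoord (w @ [at_A]) = (if e then (x, y - 1, e) else (x - 1, y, e))"
    and "wcoord (w @ [at_t]) = (x, y, \<not> e)"
proof -
  interpret group at_group by (rule group_at)
  have 1: "word_val at_group (w @ [s]) = word_val at_group w \<otimes>\<^bsub>at_group\<^esub> s"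
    if "s \<in> at_letters" for s
    using that at_words_carrier[OF assms(1)] at_letters_carrier
    by (subst word_val_append[OF group_at]) (auto simp: word_val_def)
  note 2 = coord_mult[OF word_val_closed[OF group_at at_words_carrier[OF assms(1)]]
      assms(2)[unfolded wcoord_def]]
  show "wcoord (w @ [at_a]) = (if e then (x, y + 1, e) else (x + 1, y, e))"
    and "wcoord (w @ [at_A]) = (if e then (x, y - 1, e) else (x - 1, y, e))"
    and "wcoord (w @ [at_t]) = (x, y, \<not> e)"
    using 2 by (simp_all add: wcoord_def 1 symm_at)
qed

lemma wcoord_append_replicate:
  assumes "w \<in> lists at_letters" "wcoord w = (x, y, e)"
  shows "wcoord (w @ replicate n at_a) =
      (if e then (x, y + int n, e) else (x + int n, y, e))" (is ?a)
    and "wcoord (w @ replicate n at_A) =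
      (if e then (x, y - int n, e) else (x - int n, y, e))" (is ?A)
proof -
  have 1: "w @ replicate n s \<in> lists at_letters" if "s \<in> at_letters" for s n
    using that assms(1) by auto
  have 2: "w @ replicate (Suc n) s = (w @ replicate n s) @ [s]" for n s
    by (simp add: replicate_append_same)
  show ?a
  proof (induction n)
    case (Suc n)
    then show ?case
      using wcoord_snoc(1)[OF 1[of at_a n], of x "y + int n" True]
        wcoord_snoc(1)[OF 1[of at_a n], of "x + int n" y False]
      unfolding 2 by (cases e) simp_all
  qed (simp add: assms(2))
  show ?A
  proof (induction n)
    case (Suc n)
    then show ?case
      using wcoord_snoc(2)[OF 1[of at_A n], of x "y - int n" True]
        wcoord_snoc(2)[OF 1[of at_A n], of "x - int n" y False]
      unfolding 2 by (cases e) simp_all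
  qed (simp add: assms(2))
qed

section \<open>What the numbers of letters say about the coordinates\<close>

definition a_count :: "(gen \<times> bool) list set list \<Rightarrow> nat" where
  "a_count w = length (filter (\<lambda>s. s \<noteq> at_t) w)"

lemma a_count_append [simp]: "a_count (u @ v) = a_count u + a_count v"
  by (simp add: a_count_def)

lemma a_count_Nil [simp]: "a_count [] = 0"
  by (simp add: a_count_def)

lemma a_count_Cons [simp]: "a_count (s # v) = (if s = at_t then 0 else 1) + a_count v"
  by (simp add: a_count_def)

lemma length_eq_counts: "length w = a_count w + count_list w at_t"
  by (induction w) auto

text \<open>Only letters other than \<open>t\<close> move the planar point, each by one unit. With
  \<open>p = []\<close> this bounds a whole word; with a longer \<open>p\<close> it bounds what the
  rest of the word still has to spend.\<close>

lemma l1_le_a_count: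
  assumes "p @ q \<in> lists at_letters" "wcoord p = (x, y, e)" "wcoord (p @ q) = (x', y', e')"
  shows "\<bar>x' - x\<bar> + \<bar>y' - y\<bar> \<le> int (a_count q)"
  using assms
proof (induction q arbitrary: x' y' e' rule: rev_induct)
  case (snoc s q)
  obtain i j f where c: "wcoord (p @ q) = (i, j, f)" by (metis prod_cases3)
  have IH: "\<bar>i - x\<bar> + \<bar>j - y\<bar> \<le> int (a_count q)"
    using snoc.IH[OF _ snoc.prems(2) c] snoc.prems(1) by simp
  have pq: "p @ q \<in> lists at_letters" using snoc.prems(1) by simp
  have "s \<in> at_letters" using snoc.prems(1) by simp
  then have "\<bar>x' - i\<bar> + \<bar>y' - j\<bar> \<le> int (a_count [s])"
    using snoc.prems(3) wcoord_snoc[OF pq c]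
    by (cases rule: at_letters_cases) (auto split: if_splits)
  with IH show ?case by simp
qed simp

lemma wcoord_parity:
  assumes "w \<in> lists at_letters" "wcoord w = (x, y, e)"
  shows "e \<longleftrightarrow> odd (count_list w at_t)"
  using assms
proof (induction w arbitrary: x y e rule: rev_induct)
  case (snoc s w)
  obtain i j f where c: "wcoord w = (i, j, f)" by (metis prod_cases3)
  have w: "w \<in> lists at_letters" "s \<in> at_letters" using snoc.prems(1) by auto
  have "f \<longleftrightarrow> odd (count_list w at_t)" using snoc.IH[OF w(1) c] .
  with w(2) show ?case using snoc.prems(2) wcoord_snoc[OF w(1) c]
    by (cases rule: at_letters_cases) (simp_all split: if_splits)
qed simp

text \<open>Between two letters \<open>t\<close> the Boolean is constant, so the path stays on one
  line: vertical if \<open>e\<close> holds, horizontal otherwise.\<close>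

lemma wcoord_append_no_t:
  assumes "p @ q \<in> lists at_letters" "at_t \<notin> set q"
    and "wcoord p = (x, y, e)" "wcoord (p @ q) = (x', y', e')"
  shows "e' = e" and "e \<Longrightarrow> x' = x" and "\<not> e \<Longrightarrow> y' = y"
proof -
  have "e' = e \<and> (e \<longrightarrow> x' = x) \<and> (\<not> e \<longrightarrow> y' = y)"
    using assms
  proof (induction q arbitrary: x' y' e' rule: rev_induct)
    case (snoc s q)
    obtain i j f where c: "wcoord (p @ q) = (i, j, f)" by (metis prod_cases3)
    have "f = e \<and> (e \<longrightarrow> i = x) \<and> (\<not> e \<longrightarrow> j = y)"
      using snoc.IH[OF _ _ snoc.prems(3) c] snoc.prems(1,2) by simp
    moreover have pq: "p @ q \<in> lists at_letters" using snoc.prems(1) by simp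
    moreover have s: "s \<in> at_letters" using snoc.prems(1) by simp
    from s calculation show ?case using snoc.prems(2,4) wcoord_snoc[OF pq c]
      by (cases rule: at_letters_cases) (simp_all split: if_splits)
  qed simp
  then show "e' = e" and "e \<Longrightarrow> x' = x" and "\<not> e \<Longrightarrow> y' = y" by auto
qed


section \<open>The witness words\<close>

definition witness :: "nat \<Rightarrow> (gen \<times> bool) list set list" where
  "witness n = [at_t] @ replicate n at_a @ [at_t] @ replicate n at_A @ [at_t]"

lemma witness_letters: "witness n \<in> lists at_letters"
  by (auto simp: witness_def)

lemma length_witness: "length (witness n) = 2 * n + 3"
  by (simp add: witness_def)

text \<open>The path climbs the y-axis to the corner, then runs left at height \<open>n\<close>; the
  last \<open>t\<close> only sets the Boolean.\<close>

lemma wcoord_witness_prefix: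
  "wcoord [at_t] = (0, 0, True)"
  "wcoord ([at_t] @ replicate k at_a) = (0, int k, True)"
  "wcoord ([at_t] @ replicate n at_a @ [at_t]) = (0, int n, False)"
  "wcoord ([at_t] @ replicate n at_a @ [at_t] @ replicate k at_A) = (- int k, int n, False)"
  "wcoord (witness n) = (- int n, int n, True)"
proof -
  show 1: "wcoord [at_t] = (0, 0, True)"
    using wcoord_snoc(3)[of "[]" 0 0 False] by simp
  show 2: "wcoord ([at_t] @ replicate k at_a) = (0, int k, True)" for k
    using wcoord_append_replicate(1)[OF _ 1] by simp
  show 3: "wcoord ([at_t] @ replicate n at_a @ [at_t]) = (0, int n, False)"
    using wcoord_snoc(3)[OF _ 2[of n]] by auto
  show 4: "wcoord ([at_t] @ replicate n at_a @ [at_t] @ replicate k at_A) =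
      (- int k, int n, False)" for k
    using wcoord_append_replicate(2)[OF _ 3] by auto
  show "wcoord (witness n) = (- int n, int n, True)"
    using wcoord_snoc(3)[OF _ 4[of n]] by (auto simp: witness_def)
qed

text \<open>With \<open>b = tat\<close>, the conjugate of \<open>a^n\<close> by \<open>t\<close> is
  \<open>b^n\<close>, so the witness equals \<open>b^n a^-n t\<close>. As \<open>a\<close> and
  \<open>b\<close> commute this is \<open>a^-n b^n t\<close>, which is
  \<open>a^-n t a^n\<close>.\<close>

lemma witness_word_val:
  "word_val at_group (replicate n at_A @ [at_t] @ replicate n at_a) =
   word_val at_group (witness n)"
proof -
  interpret group at_group by (rule group_at)
  have word_val_Nil: "word_val at_group [] = \<one>\<^bsub>at_group\<^esub>"
    and word_val_Cons: "word_val at_group (s # w) = s \<otimes>\<^bsub>at_group\<^esub> word_val at_group w" for s w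
    by (simp_all add: word_val_def)
  have word_val_replicate_append: "word_val at_group (replicate k s @ w) =
      s [^]\<^bsub>at_group\<^esub> k \<otimes>\<^bsub>at_group\<^esub> word_val at_group w"
    if "s \<in> at_letters" "w \<in> lists at_letters" for k s w
    using that at_letters_carrier
    by (subst word_val_append[OF group_at])
      (auto simp: word_val_replicate[OF group_at] intro!: at_words_carrier)
  let ?a = at_a and ?t = at_t
  define b where "b = ?t \<otimes>\<^bsub>at_group\<^esub> ?a \<otimes>\<^bsub>at_group\<^esub> ?t"
  have c [simp]: "?a \<in> carrier at_group" "?t \<in> carrier at_group" "b \<in> carrier at_group"
    using at_gens_carrier by (auto simp: b_def)
  have tt: "?t \<otimes>\<^bsub>at_group\<^esub> ?t = \<one>\<^bsub>at_group\<^esub>"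
    using r_inv[OF c(2)] by (simp add: inv_at_t)
  have ttx: "?t \<otimes>\<^bsub>at_group\<^esub> (?t \<otimes>\<^bsub>at_group\<^esub> x) = x" if "x \<in> carrier at_group" for x
    using that tt by (simp flip: m_assoc)
  have "([(Gen_a, True), (Gen_t, True), (Gen_a, True), (Gen_t, True)],
      [(Gen_t, True), (Gen_a, True), (Gen_t, True), (Gen_a, True)]) \<in> at_rels"
    by (simp add: at_rels_def Let_def)
  from pres_eq.relation[OF this, of "[]" "[]"]
  have comm: "?a \<otimes>\<^bsub>at_group\<^esub> b = b \<otimes>\<^bsub>at_group\<^esub> ?a"
    by (simp add: b_def at_letter_classes at_group_def pres_mult pres_class_eq)
  have "b \<otimes>\<^bsub>at_group\<^esub> at_A = at_A \<otimes>\<^bsub>at_group\<^esub> b"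
    by (metis c(1,3) comm inv_closed inv_solve_left' inv_solve_right m_assoc m_closed)
  \<comment> \<open>Commutation passes to powers one factor at a time: first to the power of
    \<open>b\<close>, then to the power of \<open>at_A\<close>.\<close>
  then have "b [^]\<^bsub>at_group\<^esub> n \<otimes>\<^bsub>at_group\<^esub> at_A = at_A \<otimes>\<^bsub>at_group\<^esub> b [^]\<^bsub>at_group\<^esub> n"
    by (rule group_commutes_pow) simp_all
  then have commA: "b [^]\<^bsub>at_group\<^esub> n \<otimes>\<^bsub>at_group\<^esub> at_A [^]\<^bsub>at_group\<^esub> n =
      at_A [^]\<^bsub>at_group\<^esub> n \<otimes>\<^bsub>at_group\<^esub> b [^]\<^bsub>at_group\<^esub> n"
    using group_commutes_pow[of at_A "b [^]\<^bsub>at_group\<^esub> n" n] by simp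
  have pow: "?t \<otimes>\<^bsub>at_group\<^esub> ?a [^]\<^bsub>at_group\<^esub> n = b [^]\<^bsub>at_group\<^esub> n \<otimes>\<^bsub>at_group\<^esub> ?t" for n :: nat
  proof (induction n)
    case (Suc n)
    have "?t \<otimes>\<^bsub>at_group\<^esub> ?a [^]\<^bsub>at_group\<^esub> Suc n =
        (?t \<otimes>\<^bsub>at_group\<^esub> ?a [^]\<^bsub>at_group\<^esub> n) \<otimes>\<^bsub>at_group\<^esub> ?a"
      by (simp add: m_assoc)
    also have "\<dots> = b [^]\<^bsub>at_group\<^esub> n \<otimes>\<^bsub>at_group\<^esub> (b \<otimes>\<^bsub>at_group\<^esub> ?t)"
      unfolding Suc by (simp add: b_def m_assoc tt)
    finally show ?case by (simp add: m_assoc)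
  qed simp
  have "word_val at_group (witness n) =
      ?t \<otimes>\<^bsub>at_group\<^esub> (?a [^]\<^bsub>at_group\<^esub> n \<otimes>\<^bsub>at_group\<^esub>
        (?t \<otimes>\<^bsub>at_group\<^esub> (at_A [^]\<^bsub>at_group\<^esub> n \<otimes>\<^bsub>at_group\<^esub> ?t)))"
    by (simp add: witness_def word_val_replicate_append word_val_Cons word_val_Nil)
  also have "\<dots> = (?t \<otimes>\<^bsub>at_group\<^esub> ?a [^]\<^bsub>at_group\<^esub> n) \<otimes>\<^bsub>at_group\<^esub>
        (?t \<otimes>\<^bsub>at_group\<^esub> (at_A [^]\<^bsub>at_group\<^esub> n \<otimes>\<^bsub>at_group\<^esub> ?t))"
    by (simp add: m_assoc)
  also have "\<dots> = (b [^]\<^bsub>at_group\<^esub> n \<otimes>\<^bsub>at_group\<^esub> at_A [^]\<^bsub>at_group\<^esub> n) \<otimes>\<^bsub>at_group\<^esub> ?t"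
    unfolding pow by (simp add: m_assoc ttx)
  also have "\<dots> = at_A [^]\<^bsub>at_group\<^esub> n \<otimes>\<^bsub>at_group\<^esub>
      (?t \<otimes>\<^bsub>at_group\<^esub> ?a [^]\<^bsub>at_group\<^esub> n)"
    unfolding commA pow by (simp add: m_assoc)
  also have "\<dots> = word_val at_group (replicate n at_A @ [at_t] @ replicate n at_a)"
    using word_val_replicate_append[of at_a "[]"]
    by (simp add: word_val_replicate_append word_val_Cons word_val_Nil)
  finally show ?thesis by simp
qed

lemma wf_at_order: "wf at_order"
proof (rule finite_acyclic_wf)
  show "finite at_order" by (simp add: at_order_def)
  show "acyclic at_order"
    using at_order_strict_total(1,2) by (simp add: acyclic_irrefl)
qed

text \<open>The word \<open>a^-n t a^n\<close> has the same value and only \<open>2 * n + 1\<close>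
  letters, two fewer than the witness.\<close>

lemma witness_not_SL: "witness n \<notin> SL_words at_group {at_a, at_t} at_order"
proof
  assume "witness n \<in> SL_words at_group {at_a, at_t} at_order"
  from SL_words_minimal[OF group_at at_gens_carrier generate_at wf_at_order
      at_order_strict_total(3) this _ witness_word_val]
  show False by (auto simp: lenlex_conv length_witness)
qed

section \<open>Competing words with one and with three letters \<open>t\<close>\<close>

text \<open>If the only \<open>t\<close> lies in \<open>p\<close>, then \<open>q\<close> moves
  vertically and \<open>x\<close> already has its final value. Otherwise \<open>p\<close> moves
  horizontally from the origin and \<open>y\<close> is still zero.\<close>

lemma one_t_misses_corner:
  assumes v: "p @ q \<in> lists at_letters" "count_list (p @ q) at_t = 1"
    and c: "wcoord p = (x, y, e)" "wcoord (p @ q) = (x', y', e')"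
  shows "x = x' \<or> y = 0"
proof (cases "at_t \<in> set p")
  case True
  then have "count_list p at_t \<noteq> 0" by (simp add: count_list_0_iff)
  then have *: "count_list p at_t = 1" "at_t \<notin> set q"
    using v(2) by (simp_all flip: count_list_0_iff)
  have "e" using wcoord_parity[OF _ c(1)] v(1) *(1) by simp
  then show ?thesis using wcoord_append_no_t(2)[OF v(1) *(2) c] by simp
next
  case False
  then show ?thesis using wcoord_append_no_t(3)[of "[]" p] v(1) c(1) by simp
qed

text \<open>Among the words with three letters \<open>t\<close> the witness is smallest: leaving it earlier at a
  smaller letter either wastes a letter \<open>a\<close> or uses up the last \<open>t\<close> too soon.\<close>

lemma witness_lex_least:
  assumes v: "v \<in> lists at_letters" "wcoord v = (- int n, int n, True)"
    and cnt: "a_count v = 2 * n" "count_list v at_t = 3"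
  shows "(v, witness n) \<notin> lex at_order"
proof
  assume "(v, witness n) \<in> lex at_order"
  then obtain p s u r u' where vs: "v = p @ s # u" and wr: "witness n = p @ r # u'"
    and sr: "(s, r) \<in> at_order"
    by (auto simp: lex_conv)
  have p: "p = take (length p) (witness n)" and r: "r = witness n ! length p"
    and len: "length p < 2 * n + 3"
    using wr length_witness[of n] by simp_all
  have ps: "p @ [s] \<in> lists at_letters" "p \<in> lists at_letters" using v(1) unfolding vs by auto
  \<comment> \<open>A budget: after \<open>p @ [s]\<close> the remaining letters must cover the
    distance left to the endpoint, and only \<open>2 * n\<close> letters other than \<open>t\<close>
    are available. Prefixes of the witness meet this bound with equality, so one step in a wrong
    direction exceeds it.\<close>
  have far: "\<bar>- int n - i\<bar> + \<bar>int n - j\<bar> + int (a_count (p @ [s])) \<le> 2 * int n"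
    if "wcoord (p @ [s]) = (i, j, f)" for i j f
    using l1_le_a_count[of "p @ [s]" u i j f "- int n" "int n" True] that v cnt(1)
    unfolding vs by simp
  \<comment> \<open>The five ranges are the first \<open>t\<close>, the block of \<open>a\<close>,
    the middle \<open>t\<close>, the block of inverses and the last \<open>t\<close>. A branch to
    \<open>a\<close> breaks the budget \<open>far\<close> in every range but the second.\<close>
  consider "length p = 0" | "1 \<le> length p" "length p \<le> n" | "length p = n + 1"
    | "n + 2 \<le> length p" "length p \<le> 2 * n + 1" | "length p = 2 * n + 2"
    using len by linarith
  then show False
  proof cases
    case 1
    then have "s = at_a" using r sr by (auto simp: witness_def at_order_def)
    then show False using far[of 1 0 False] 1 wcoord_snoc(1)[of "[]" 0 0 False] by simp
  next
    case 2
    then obtain k where k: "length p = Suc k" "k < n" by (cases "length p") auto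
    \<comment> \<open>Inside the block of \<open>a\<close> no branch is possible, because
      \<open>a\<close> is the least letter.\<close>
    have "r = at_a" using r k(2) unfolding k(1) by (simp add: witness_def nth_append)
    then show False using sr by (auto simp: at_order_def)
  next
    case 3
    then have "p = [at_t] @ replicate n at_a" "r = at_t"
      using p r by (simp_all add: witness_def nth_append)
    moreover from this have "s = at_a" using sr by (auto simp: at_order_def)
    ultimately show False
      using far[of 0 "int n + 1" True] wcoord_witness_prefix(2)[of n]
        wcoord_snoc(1)[OF ps(2), of 0 "int n" True]
      by (simp add: a_count_def)
  next
    case 4
    define k where "k = length p - (n + 2)"
    have k: "length p = n + 2 + k" "k < n" using 4 by (auto simp: k_def)
    have pk: "p = [at_t] @ replicate n at_a @ [at_t] @ replicate k at_A" and "r = at_A"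
      using p r k by (simp_all add: witness_def nth_append min_def)
    then consider "s = at_a" | "s = at_t" using sr by (auto simp: at_order_def)
    then show False
    proof cases
      case 1
      then show False
        using far[of "1 - int k" "int n" False] wcoord_witness_prefix(4)[of n k] k(2)
          wcoord_snoc(1)[OF ps(2), of "- int k" "int n" False] pk
        by (simp add: a_count_def)
    next
      case 2
      \<comment> \<open>Here the third and last \<open>t\<close> comes early: from now on the path
        is vertical, so \<open>x\<close> stays at \<open>- int k\<close> and never reaches
        \<open>- int n\<close>.\<close>
      have c: "wcoord (p @ [s]) = (- int k, int n, True)"
        using wcoord_snoc(3)[OF ps(2), of "- int k" "int n" False] wcoord_witness_prefix(4)[of n k] pk 2 by simp
      have "count_list (p @ [s]) at_t = 3"
        unfolding pk 2 by (simp add: count_list_0_iff)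
      then have "at_t \<notin> set u" using cnt(2) 2 unfolding vs by (simp add: count_list_0_iff)
      from wcoord_append_no_t(2)[OF _ this c] v k(2) show False unfolding vs by auto
    qed
  next
    case 5
    then have "p = [at_t] @ replicate n at_a @ [at_t] @ replicate n at_A" "r = at_t"
      using p r by (simp_all add: witness_def nth_append)
    moreover from this have "s = at_a" using sr by (auto simp: at_order_def)
    ultimately show False
      using far[of "1 - int n" "int n" False] wcoord_witness_prefix(4)[of n n]
        wcoord_snoc(1)[OF ps(2), of "- int n" "int n" False]
      by (simp add: a_count_def)
  qed
qed

theorem proposition4p2:
  "\<not> SL_FFTP at_group {at_a, at_t} at_order"
proof
  assume "SL_FFTP at_group {at_a, at_t} at_order"
  then obtain K where K: "\<And>w. w \<in> lists at_letters \<Longrightarrow>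
      w \<notin> SL_words at_group {at_a, at_t} at_order \<Longrightarrow>
      \<exists>v\<in>lists at_letters. async_fellow_travel at_group {at_a, at_t} K v w \<and>
        word_val at_group w = word_val at_group v \<and> (v, w) \<in> lenlex at_order"
    unfolding SL_FFTP_def by blast
  \<comment> \<open>A word with a single \<open>t\<close> stays at distance at least
    \<open>n\<close> from the corner, so \<open>n\<close> has to exceed \<open>K\<close>.\<close>
  define n where "n = K + 1"
  obtain v where v: "v \<in> lists at_letters"
    and ft: "async_fellow_travel at_group {at_a, at_t} K v (witness n)"
    and val: "word_val at_group (witness n) = word_val at_group v"
    and less: "(v, witness n) \<in> lenlex at_order"
    using K[OF witness_letters witness_not_SL] by blast
  have cv: "wcoord v = (- int n, int n, True)"
    using val wcoord_witness_prefix(5)[of n] by (simp add: wcoord_def)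
  \<comment> \<open>The corner is vertex \<open>n + 2\<close> of the witness path, after
    \<open>t\<close>, the block of \<open>a\<close> and the second \<open>t\<close>.\<close>
  have corner: "take (n + 2) (witness n) = [at_t] @ replicate n at_a @ [at_t]"
    by (simp add: witness_def)
  \<comment> \<open>Vertex \<open>i\<close> is the partner on \<open>v\<close> that fellow
    travelling assigns to the corner.\<close>
  obtain i where i: "cayley_dist at_group {at_a, at_t}
      (word_path at_group (witness n) (n + 2)) (word_path at_group v i) \<le> K"
    using ft length_witness[of n] unfolding async_fellow_travel_def by force
  define p where "p = take i v"
  define q where "q = drop i v"
  have pq: "v = p @ q" by (simp add: p_def q_def)
  obtain x y e where c: "wcoord p = (x, y, e)" by (metis prod_cases3)
  have "\<bar>x\<bar> + \<bar>y - int n\<bar> \<le> int K"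
  proof -
    have "p \<in> lists at_letters" using v unfolding pq by simp
    moreover have "[at_t] @ replicate n at_a @ [at_t] \<in> lists at_letters" by auto
    ultimately have "l1_dist (word_val at_group ([at_t] @ replicate n at_a @ [at_t]))
        (word_val at_group p) \<le> int K"
      using l1_dist_le_cayley_dist[OF word_val_closed[OF group_at at_words_carrier]
          word_val_closed[OF group_at at_words_carrier]] i
      unfolding word_path_def corner p_def[symmetric] by (meson of_nat_mono order_trans)
    then show ?thesis
      using c wcoord_witness_prefix(3)[of n] by (simp add: l1_dist_def wcoord_def)
  qed
  \<comment> \<open>The partner is within \<open>K < n\<close> of the corner, hence on neither line
    to which a word with one \<open>t\<close> is confined.\<close>
  then have "x \<noteq> - int n" "y \<noteq> 0" by (auto simp: n_def)
  then have "count_list v at_t \<noteq> 1"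
    using one_t_misses_corner[of p q] v cv c unfolding pq by auto
  moreover have "odd (count_list v at_t)" using wcoord_parity[OF v cv] by simp
  ultimately have "count_list v at_t \<ge> 3"
    by presburger
  moreover have "a_count v \<ge> 2 * n"
    using l1_le_a_count[of "[]" v 0 0 False "- int n" "int n" True] v cv by simp
  moreover have "length v \<le> 2 * n + 3"
    using lenlex_length[OF less] by (simp add: length_witness)
  \<comment> \<open>The lower bounds \<open>2 * n\<close> and \<open>3\<close> add up to the largest
    possible length, so both are attained. Thus \<open>v\<close> is as long as the witness and must
    precede it lexicographically.\<close>
  ultimately have *: "a_count v = 2 * n" "count_list v at_t = 3"
    using length_eq_counts[of v] by linarith+
  have "length v = length (witness n)"
    using * length_eq_counts[of v] by (simp add: length_witness)
  then have "(v, witness n) \<in> lex at_order" using less by (auto simp: lenlex_conv)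
  then show False using witness_lex_least[OF v cv *] by blast
qed

end
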